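(* Consider a problem instance in the class $I_{\text{sub}}$ such that for every $t\in\mathcal{T}$ we have $f^t(x^t)=a^t\bar{f}^t\big(\frac{x^t}{a^t}+b^t\big)$ for an increasing, strictly convex, differentiable function $\bar{f}^t$ and parameters $a^t\in\mathbb{R}_{>0}$, $b^t\in\mathbb{R}$. Let $(\mu^*,\lambda^* )$ be optimal Lagrange multipliers and let $(\hat{\mu},\hat{\lambda})$ be Lagrange multipliers with $(\hat{\mu},\hat{\lambda})\le(\mu^*,\lambda^* )$ component-wise. Assume that for every $t\in\mathcal{T}$ the values $\nu^t(\hat{\mu},\hat{\lambda})$ and $\nu^t(\mu^*,\lambda^* )$ lie in the range of $\nabla f^t$. Then $$\sum_{t \in \mathcal{T}} f^t\big((\nabla f^t)^{-1}(\nu^t(\hat{\mu},\hat{\lambda}))\big) - \sum_{t \in \mathcal{T}} f^t\big((\nabla f^t)^{-1}(\nu^t(\mu^*,\lambda^* ))\big)=\sum_{t \in \mathcal{T}} a^t \bar{f}^t\big((\nabla \bar{f}^t)^{-1}(\nu^t(\hat{\mu},\hat{\lambda}))\big) - \sum_{t \in \mathcal{T}} a^t \bar{f}^t\big((\nabla \bar{f}^t)^{-1}(\nu^t(\mu^*,\lambda^* ))\big),$$ and consequently $$\sum_{t \in \mathcal{T}} f^t (\hat{x}^t(\hat{\mu},\hat{\lambda})) - \sum_{t \in \mathcal{T}} f^t (\hat{x}^t(\mu^*,\lambda^* )) \leq \sum_{t \in \mathcal{T}} a^t \bar{f}^t\big((\nabla \bar{f}^t)^{-1}(\nu^t(\hat{\mu},\hat{\lambda}))\big)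 - \sum_{t \in \mathcal{T}} a^t \bar{f}^t\big((\nabla \bar{f}^t)^{-1}(\nu^t(\mu^*,\lambda^* ))\big).$$
   Context: Let $T\ge 1$ be an integer and $\mathcal{T}=\{1,\ldots,T\}$. A function $r:2^{\mathcal{T}}\to\mathbb{R}$ is submodular if $r(\mathcal{X}\cup\mathcal{Y})+r(\mathcal{X}\cap\mathcal{Y})\le r(\mathcal{X})+r(\mathcal{Y})$ for all $\mathcal{X},\mathcal{Y}\subseteq\mathcal{T}$; we assume $r(\emptyset)=0$. Its base polyhedron is $\mathcal{B}(r)=\{x\in\mathbb{R}^T : \sum_{t\in\mathcal{X}}x^t\le r(\mathcal{X})\ \forall \mathcal{X}\subset\mathcal{T},\ \sum_{t\in\mathcal{T}}x^t=r(\mathcal{T})\}$ (superscripts on $x$, $a$, $b$, $f$, $\nu$ are indices). The class $I_{\text{sub}}$ consists of all problems $\min \sum_{t\in\mathcal{T}} f^t(x^t)$ subject to $x=(x^1,\ldots,x^T)\in\mathcal{B}(r)$, where $r$ is submodular on $\mathcal{T}$ and each $f^t$ is a real-valued increasing, strictly convex, continuously differentiable function of one real variable, defined on an interval $D^t\subseteq\mathbb{R}$ containing $\mathcal{C}^t:=[\,r(\mathcal{T})-r(\mathcal{T}\setminus\{t\}),\ r(\{t\})\,]$. When $f^t(x^t)=a^t\bar f^t(x^t/a^t+b^t)$, the function $\bar f^t$ is defined on the interval $\{x/a^t+b^t: x\in D^t\}$. Lagrange multipliers: let $\mathcal{M}=\{\mathcal{X}\subseteq\mathcal{T}: 1<|\mathcal{X}|<T\}$.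 A vector of Lagrange multipliers is $(\mu,\lambda)$ with $\mu=(\mu_{\mathcal{X}})_{\mathcal{X}\in\mathcal{M}}$ (for the constraints $\sum_{t\in\mathcal{X}}x^t\le r(\mathcal{X})$) and a scalar $\lambda=\lambda_{\mathcal{T}}$ (for the constraint $\sum_{t\in\mathcal{T}}x^t=r(\mathcal{T})$). Put $\nu^t(\mu,\lambda):=-\sum_{\mathcal{X}\in\mathcal{M}:\,\mathcal{X}\ni t}\mu_{\mathcal{X}}-\lambda_{\mathcal{T}}$. Up to an additive constant, the local Lagrangian of stage $t$ is $L^t(x^t,\mu,\lambda)=f^t(x^t)-\nu^t(\mu,\lambda)\,x^t$. Local Lagrangian solution: $x^t(\mu,\lambda)$ is the unique minimizer of $L^t(\cdot,\mu,\lambda)$ over $\mathcal{C}^t$. The multipliers $(\mu^*,\lambda^* )$ are called optimal if $(x^t(\mu^*,\lambda^* ))_{t\in\mathcal{T}}$ is an optimal solution of the problem instance; it is assumed throughout that such multipliers exist. Online solution: $\hat{x}(\mu,\lambda)=(\hat{x}^1(\mu,\lambda),\ldots,\hat{x}^T(\mu,\lambda))$ is defined recursively for $\bar t=1,\ldots,T$: $\hat{x}^{\bar t}(\mu,\lambda)$ is the unique minimizer of $L^{\bar t}(\cdot,\mu,\lambda)$ over the set $\mathcal{C}^{\bar t}_{\text{proj}}$ of all $y\in\mathbb{R}$ for which there exist $x^{\bar t+1},\ldots,x^T$ with $(\hat{x}^1(\mu,\lambda),\ldots,\hat{x}^{\bar t-1}(\mu,\lambda),y,x^{\bar t+1},\ldots,x^T)\in\mathcal{B}(r)$.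 $\nabla f^t$, $\nabla\bar f^t$ denote the derivatives of $f^t$, $\bar f^t$ on their domains (one-sided at endpoints that belong to the domain), and $(\nabla f^t)^{-1}$, $(\nabla\bar f^t)^{-1}$ are their inverses, defined on the respective ranges and taking values in the respective domains. *)

theory Defs
  imports "HOL-Analysis.Analysis"
begin

text \<open>
  Vectors of $\mathbb{R}^T$ are functions \<open>x :: nat \<Rightarrow> real\<close> of which only the
  coordinates in \<open>{1..T}\<close> are ever used, and set functions are only used on subsets
  of \<open>{1..T}\<close>.
\<close>

definition submodular_on :: "nat \<Rightarrow> (nat set \<Rightarrow> real) \<Rightarrow> bool" where
  "submodular_on T r \<longleftrightarrow>
     (\<forall>X Y. X \<subseteq> {1..T} \<longrightarrow> Y \<subseteq> {1..T} \<longrightarrow> r (X \<union> Y) + r (X \<inter> Y) \<le> r X + r Y)"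

definition base_polyhedron :: "nat \<Rightarrow> (nat set \<Rightarrow> real) \<Rightarrow> (nat \<Rightarrow> real) set" where
  "base_polyhedron T r =
     {x. (\<forall>X. X \<subset> {1..T} \<longrightarrow> (\<Sum>t\<in>X. x t) \<le> r X) \<and> (\<Sum>t\<in>{1..T}. x t) = r {1..T}}"

definition strictly_convex_on :: "real set \<Rightarrow> (real \<Rightarrow> real) \<Rightarrow> bool" where
  "strictly_convex_on D g \<longleftrightarrow>
     (\<forall>x\<in>D. \<forall>y\<in>D. \<forall>u. x \<noteq> y \<longrightarrow> 0 < u \<longrightarrow> u < 1 \<longrightarrow>
        g ((1 - u) * x + u * y) < (1 - u) * g x + u * g y)"

text \<open>
  The derivative relative to the domain \<open>D\<close>; it is one-sided at endpoints of an
  interval \<open>D\<close> that belong to \<open>D\<close>. Values of \<open>g\<close> outside \<open>D\<close> play no role.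
\<close>

definition nabla :: "real set \<Rightarrow> (real \<Rightarrow> real) \<Rightarrow> real \<Rightarrow> real" where
  "nabla D g x = vector_derivative g (at x within D)"

definition nabla_inv :: "real set \<Rightarrow> (real \<Rightarrow> real) \<Rightarrow> real \<Rightarrow> real" where
  "nabla_inv D g = inv_into D (nabla D g)"

text \<open>The domain of \<open>g\<close> when \<open>x \<mapsto> \<alpha> * g (x / \<alpha> + \<beta>)\<close> has domain \<open>D\<close>.\<close>

definition rescaled_domain :: "real \<Rightarrow> real \<Rightarrow> real set \<Rightarrow> real set" where
  "rescaled_domain \<alpha> \<beta> D = (\<lambda>x. x / \<alpha> + \<beta>) ` D"

definition local_range :: "nat \<Rightarrow> (nat set \<Rightarrow> real) \<Rightarrow> nat \<Rightarrow> real set" where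
  "local_range T r t = {r {1..T} - r ({1..T} - {t}) .. r {t}}"

text \<open>
  Problem instances: \<open>f t\<close> is the cost function of stage \<open>t\<close> and \<open>D t\<close> its domain. A
  one-point domain is excluded because derivatives make no sense there.
\<close>

definition I_sub :: "nat \<Rightarrow> (nat set \<Rightarrow> real) \<Rightarrow> (nat \<Rightarrow> real set) \<Rightarrow> (nat \<Rightarrow> real \<Rightarrow> real) \<Rightarrow> bool"
  where
  "I_sub T r D f \<longleftrightarrow>
     1 \<le> T \<and> submodular_on T r \<and> r {} = 0 \<and>
     (\<forall>t\<in>{1..T}.
        is_interval (D t) \<and> interior (D t) \<noteq> {} \<and> local_range T r t \<subseteq> D t \<and>
        mono_on (D t) (f t) \<and> strictly_convex_on (D t) (f t) \<and>
        f t differentiable_on D t \<and> continuous_on (D t) (nabla (D t) (f t)))"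

definition optimal_solution ::
  "nat \<Rightarrow> (nat set \<Rightarrow> real) \<Rightarrow> (nat \<Rightarrow> real \<Rightarrow> real) \<Rightarrow> (nat \<Rightarrow> real) \<Rightarrow> bool" where
  "optimal_solution T r f x \<longleftrightarrow>
     is_arg_min (\<lambda>x. \<Sum>t\<in>{1..T}. f t (x t)) (\<lambda>x. x \<in> base_polyhedron T r) x"

definition multiplier_sets :: "nat \<Rightarrow> nat set set" where
  "multiplier_sets T = {X. X \<subseteq> {1..T} \<and> 1 < card X \<and> card X < T}"

definition nu :: "nat \<Rightarrow> (nat set \<Rightarrow> real) \<Rightarrow> real \<Rightarrow> nat \<Rightarrow> real" where
  "nu T \<mu> l t = - (\<Sum>X\<in>{X \<in> multiplier_sets T. t \<in> X}. \<mu> X) - l"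

definition local_lagrangian ::
  "nat \<Rightarrow> (nat \<Rightarrow> real \<Rightarrow> real) \<Rightarrow> (nat set \<Rightarrow> real) \<Rightarrow> real \<Rightarrow> nat \<Rightarrow> real \<Rightarrow> real" where
  "local_lagrangian T f \<mu> l t y = f t y - nu T \<mu> l t * y"

definition minimizer :: "(real \<Rightarrow> real) \<Rightarrow> real set \<Rightarrow> real" where
  "minimizer g S = (THE y. is_arg_min g (\<lambda>y. y \<in> S) y)"

definition local_solution ::
  "nat \<Rightarrow> (nat set \<Rightarrow> real) \<Rightarrow> (nat \<Rightarrow> real \<Rightarrow> real) \<Rightarrow> (nat set \<Rightarrow> real) \<Rightarrow> real \<Rightarrow> nat \<Rightarrow> real"
  where
  "local_solution T r f \<mu> l t = minimizer (local_lagrangian T f \<mu> l t) (local_range T r t)"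

definition optimal_multipliers ::
  "nat \<Rightarrow> (nat set \<Rightarrow> real) \<Rightarrow> (nat \<Rightarrow> real \<Rightarrow> real) \<Rightarrow> (nat set \<Rightarrow> real) \<Rightarrow> real \<Rightarrow> bool" where
  "optimal_multipliers T r f \<mu> l \<longleftrightarrow> optimal_solution T r f (local_solution T r f \<mu> l)"

definition projected_range ::
  "nat \<Rightarrow> (nat set \<Rightarrow> real) \<Rightarrow> (nat \<Rightarrow> real) \<Rightarrow> nat \<Rightarrow> real set" where
  "projected_range T r z t =
     {y. \<exists>x \<in> base_polyhedron T r. (\<forall>s\<in>{1..<t}. x s = z s) \<and> x t = y}"

text \<open>
  The vector passed to \<open>projected_range\<close> carries the decisions of the stages before
  \<open>t\<close>; its zero padding is never inspected and only makes the recursion well-founded.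
\<close>

function online_solution ::
  "nat \<Rightarrow> (nat set \<Rightarrow> real) \<Rightarrow> (nat \<Rightarrow> real \<Rightarrow> real) \<Rightarrow> (nat set \<Rightarrow> real) \<Rightarrow> real \<Rightarrow> nat \<Rightarrow> real"
  where
  "online_solution T r f \<mu> l t =
     minimizer (local_lagrangian T f \<mu> l t)
       (projected_range T r (\<lambda>s. if s < t then online_solution T r f \<mu> l s else 0) t)"
  by pat_completeness auto
termination
  by (relation "Wellfounded.measure (\<lambda>(T, r, f, \<mu>, l, t). t)") auto

declare online_solution.simps [simp del]

end

theory Submission
  imports Defs
begin

text \<open>
  Compare the online solution \<open>x\<close> for the smaller multipliers with the optimum \<open>y\<close>, stage
  by stage. Both lie in the base polyhedron, and \<open>x t\<close> is the point of an interval closest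
  to the unconstrained minimizer \<open>\<gamma> t\<close>. If \<open>x t\<close> were larger than both \<open>y t\<close> and \<open>\<gamma> t\<close>,
  then \<open>x t\<close> could not be decreased, and no earlier \<open>x s < y s\<close> could be increased, without
  changing earlier stages. Each of these obstructions is a tight set avoiding \<open>t\<close>;
  tight sets are closed under union, and on the complement of their union \<open>x\<close> dominates \<open>y\<close>,
  strictly at \<open>t\<close>, contradicting that \<open>y\<close> is in the base polyhedron. Hence
  \<open>x t \<le> max (y t) (\<gamma> t)\<close>, which bounds the cost increase of every single stage.
\<close>

section \<open>Strictly convex functions on an interval\<close>

lemma strictly_convex_onD:
  assumes "strictly_convex_on D g" "x \<in> D" "y \<in> D" "x \<noteq> y" "0 < u" "u < 1"
  shows "g ((1 - u) * x + u * y) < (1 - u) * g x + u * g y"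
  using assms unfolding strictly_convex_on_def by blast

lemma strictly_convex_on_subset:
  assumes "strictly_convex_on D g" "S \<subseteq> D"
  shows "strictly_convex_on S g"
  using assms unfolding strictly_convex_on_def by blast

lemma strictly_convex_on_diff_linear:
  fixes \<nu> :: real
  assumes "strictly_convex_on D g"
  shows "strictly_convex_on D (\<lambda>y. g y - \<nu> * y)"
  unfolding strictly_convex_on_def
proof (intro ballI allI impI)
  fix x y u :: real
  assume "x \<in> D" "y \<in> D" "x \<noteq> y" "0 < u" "u < 1"
  from strictly_convex_onD[OF assms this]
  show "g ((1 - u) * x + u * y) - \<nu> * ((1 - u) * x + u * y)
      < (1 - u) * (g x - \<nu> * x) + u * (g y - \<nu> * y)"
    by (simp add: algebra_simps)
qed

lemma is_interval_convex_comb: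
  fixes D :: "real set"
  assumes "is_interval D" "x \<in> D" "y \<in> D" "0 \<le> u" "u \<le> 1"
  shows "(1 - u) * x + u * y \<in> D"
  using convexD_alt[of D x y u] assms by (simp add: is_interval_convex)

section \<open>Derivatives relative to an interval, tangent lines and inverse derivatives\<close>

lemma at_within_interval_neq_bot:
  fixes D :: "real set"
  assumes "is_interval D" "interior D \<noteq> {}" "x \<in> D"
  shows "at x within D \<noteq> bot"
proof -
  have "D \<noteq> {x}" using assms(2) by (metis interior_singleton)
  moreover have "connected D" using assms(1) by (simp add: is_interval_connected)
  ultimately have "x islimpt D" using assms(3) by (intro connected_imp_perfect) auto
  thus ?thesis by (simp add: trivial_limit_within)
qed

lemma has_real_derivative_nabla:
  assumes "g differentiable_on D" "x \<in> D"
  shows "(g has_real_derivative nabla D g x) (at x within D)"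
  using assms unfolding nabla_def differentiable_on_def has_real_derivative_iff_has_vector_derivative
  by (simp add: vector_derivative_works)

text \<open>Limits within \<open>D\<close> are unique because no point of \<open>D\<close> is
  isolated, so any derivative found by calculus rules is the value of \<open>nabla\<close>.\<close>

lemma nabla_eqI:
  assumes "is_interval D" "interior D \<noteq> {}" "x \<in> D"
    and "(g has_real_derivative d) (at x within D)"
  shows "nabla D g x = d"
  unfolding nabla_def
  using assms by (intro vector_derivative_within at_within_interval_neq_bot)
    (auto simp: has_real_derivative_iff_has_vector_derivative)

text \<open>Convexity bounds every difference quotient along the segment from \<open>x\<close> to
  \<open>y\<close> by \<open>g y - g x\<close>; the tangent slope is their limit. Parametrizing the
  segment by \<open>u\<close> treats both directions and the endpoints of \<open>D\<close>
  alike.\<close>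

lemma above_tangent:
  assumes D: "is_interval D" and conv: "strictly_convex_on D g" and diff: "g differentiable_on D"
    and x: "x \<in> D" and y: "y \<in> D"
  shows "nabla D g x * (y - x) \<le> g y - g x"
proof (cases "y = x")
  case False
  define p where "p u = x + u * (y - x)" for u
  have pD: "p ` {0..1} \<subseteq> D"
    using is_interval_convex_comb[OF D x y] by (auto simp: p_def algebra_simps)
  have "(g has_real_derivative nabla D g (p 0)) (at (p 0) within p ` {0..1})"
    using has_field_derivative_subset[OF has_real_derivative_nabla[OF diff x] pD] by (simp add: p_def)
  moreover have "(p has_real_derivative (y - x)) (at 0 within {0..1})"
    unfolding p_def by (auto intro!: derivative_eq_intros)
  ultimately have "(g \<circ> p has_real_derivative nabla D g (p 0) * (y - x)) (at 0 within {0..1})"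
    by (rule DERIV_image_chain)
  hence lim: "((\<lambda>u. (g (p u) - g x) / u) \<longlongrightarrow> nabla D g x * (y - x)) (at 0 within {0..1})"
    by (simp add: has_field_derivative_iff p_def)
  have "\<forall>\<^sub>F u in at 0 within {0..1}. (g (p u) - g x) / u \<le> g y - g x"
    unfolding eventually_at_filter
  proof (intro always_eventually allI impI)
    fix u :: real
    assume "u \<noteq> 0" "u \<in> {0..1}"
    hence u: "0 < u" "u \<le> 1" by auto
    have "g (p u) \<le> (1 - u) * g x + u * g y"
    proof (cases "u = 1")
      case False
      thus ?thesis using strictly_convex_onD[OF conv x y, of u] \<open>y \<noteq> x\<close> u
        by (simp add: p_def algebra_simps)
    qed (simp add: p_def)
    thus "(g (p u) - g x) / u \<le> g y - g x"
      using u by (simp add: field_simps)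
  qed
  moreover have "at (0::real) within {0..1} \<noteq> bot"
    by (simp add: trivial_limit_within)
  ultimately show ?thesis using tendsto_upperbound[OF lim] by blast
qed simp

text \<open>The limit behind \<open>above_tangent\<close> loses strictness; applying it at the
  midpoint, where strict convexity leaves a gap, recovers it.\<close>

lemma strictly_above_tangent:
  assumes D: "is_interval D" and conv: "strictly_convex_on D g" and diff: "g differentiable_on D"
    and x: "x \<in> D" and y: "y \<in> D" and "y \<noteq> x"
  shows "nabla D g x * (y - x) < g y - g x"
proof -
  define m where "m = (x + y) / 2"
  have m: "m \<in> D" "g m < (g x + g y) / 2"
    using is_interval_convex_comb[OF D x y, of "1/2"] strictly_convex_onD[OF conv x y, of "1/2"] \<open>y \<noteq> x\<close>
    by (simp_all add: m_def add_divide_distrib)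
  have "nabla D g x * (m - x) \<le> g m - g x"
    by (rule above_tangent[OF D conv diff x m(1)])
  moreover have "m - x = (y - x) / 2" by (simp add: m_def field_simps)
  ultimately show ?thesis using m(2) by simp
qed

text \<open>If two distinct points had the same slope, the two strict tangent inequalities would add
  up to \<open>0 < 0\<close>.\<close>

lemma inj_on_nabla:
  assumes "is_interval D" "strictly_convex_on D g" "g differentiable_on D"
  shows "inj_on (nabla D g) D"
proof (rule inj_onI, rule ccontr)
  fix x y assume *: "x \<in> D" "y \<in> D" "nabla D g x = nabla D g y" "x \<noteq> y"
  show False
    using strictly_above_tangent[OF assms, of x y] strictly_above_tangent[OF assms, of y x] *
    by (simp add: algebra_simps)
qed

lemma nabla_inv_mono:
  assumes D: "is_interval D" "strictly_convex_on D g" "g differentiable_on D"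
    and \<nu>: "\<nu>1 \<in> nabla D g ` D" "\<nu>2 \<in> nabla D g ` D" "\<nu>1 \<le> \<nu>2"
  shows "nabla_inv D g \<nu>1 \<le> nabla_inv D g \<nu>2"
proof (rule ccontr)
  let ?x = "nabla_inv D g \<nu>1" and ?y = "nabla_inv D g \<nu>2"
  assume lt: "\<not> ?x \<le> ?y"
  have in_D: "?x \<in> D" "?y \<in> D" and eq: "nabla D g ?x = \<nu>1" "nabla D g ?y = \<nu>2"
    unfolding nabla_inv_def using \<nu> by (auto intro: inv_into_into simp: f_inv_into_f)
  \<comment> \<open>Adding the tangent inequalities at the two preimages cancels all values of
    \<open>g\<close>.\<close>
  have "\<nu>1 * (?y - ?x) < g ?y - g ?x" "\<nu>2 * (?x - ?y) < g ?x - g ?y"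
    using strictly_above_tangent[OF D in_D] strictly_above_tangent[OF D in_D(2,1)] lt eq by auto
  hence "(\<nu>2 - \<nu>1) * (?x - ?y) < 0" by (simp add: algebra_simps)
  moreover have "(\<nu>2 - \<nu>1) * (?x - ?y) \<ge> 0" using \<nu>(3) lt by simp
  ultimately show False by simp
qed

text \<open>By the chain rule the outer factor \<alpha> cancels the inner derivative
  \<open>1 / \<alpha>\<close>, so slopes agree at corresponding points and the affine map carries
  one inverse derivative to the other.\<close>

lemma nabla_inv_rescaled:
  assumes D: "is_interval D" "interior D \<noteq> {}" "strictly_convex_on D g" "g differentiable_on D"
    and "\<alpha> > 0"
    and h: "h differentiable_on rescaled_domain \<alpha> \<beta> D"
    and g_eq: "\<And>x. x \<in> D \<Longrightarrow> g x = \<alpha> * h (x / \<alpha> + \<beta>)"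
    and \<nu>: "\<nu> \<in> nabla D g ` D"
  shows "nabla_inv (rescaled_domain \<alpha> \<beta> D) h \<nu> = nabla_inv D g \<nu> / \<alpha> + \<beta>"
proof -
  let ?p = "\<lambda>x. x / \<alpha> + \<beta>" and ?E = "rescaled_domain \<alpha> \<beta> D"
  have nabla_eq: "nabla ?E h (?p x) = nabla D g x" if x: "x \<in> D" for x
  proof -
    have "(h has_real_derivative nabla ?E h (?p x)) (at (?p x) within ?p ` D)"
      using has_real_derivative_nabla[OF h, of "?p x"] imageI[OF x, of ?p] by (simp add: rescaled_domain_def)
    moreover have "(?p has_real_derivative 1 / \<alpha>) (at x within D)"
      using \<open>\<alpha> > 0\<close> by (auto intro!: derivative_eq_intros)
    ultimately have "(h \<circ> ?p has_real_derivative nabla ?E h (?p x) * (1 / \<alpha>)) (at x within D)"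
      by (rule DERIV_image_chain)
    hence "((\<lambda>x. \<alpha> * (h \<circ> ?p) x) has_real_derivative \<alpha> * (nabla ?E h (?p x) * (1 / \<alpha>))) (at x within D)"
      by (rule DERIV_cmult)
    moreover have "\<alpha> * (nabla ?E h (?p x) * (1 / \<alpha>)) = nabla ?E h (?p x)"
      using \<open>\<alpha> > 0\<close> by simp
    ultimately have "((\<lambda>x. \<alpha> * h (?p x)) has_real_derivative nabla ?E h (?p x)) (at x within D)"
      by (simp add: o_def)
    hence "(g has_real_derivative nabla ?E h (?p x)) (at x within D)"
      by (rule has_field_derivative_transform_within[where d = 1]) (use x g_eq in auto)
    from nabla_eqI[OF D(1,2) x this] show ?thesis by simp
  qed
  \<comment> \<open>Injectivity passes from \<open>g\<close> to \<open>h\<close> through the equal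
    slopes; it makes \<open>inv_into\<close> return the corresponding point.\<close>
  have "inj_on (nabla ?E h) ?E"
    using inj_on_nabla[OF D(1,3,4)] nabla_eq unfolding rescaled_domain_def inj_on_def by auto
  moreover have "nabla_inv D g \<nu> \<in> D" "nabla D g (nabla_inv D g \<nu>) = \<nu>"
    unfolding nabla_inv_def using \<nu> by (auto intro: inv_into_into simp: f_inv_into_f)
  ultimately show ?thesis
    using nabla_eq[of "nabla_inv D g \<nu>"]
    by (auto simp: nabla_inv_def rescaled_domain_def intro!: inv_into_f_eq)
qed

section \<open>Minimizers over subintervals of the domain\<close>

lemma is_arg_min_unique:
  assumes S: "is_interval S" and conv: "strictly_convex_on S g"
    and p: "is_arg_min g (\<lambda>y. y \<in> S) p" and q: "is_arg_min g (\<lambda>y. y \<in> S) q"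
  shows "p = q"
proof (rule ccontr)
  assume "p \<noteq> q"
  have in_S: "p \<in> S" "q \<in> S" using p q by (auto simp: is_arg_min_def)
  have eq: "g p = g q" using p q in_S by (auto simp: is_arg_min_def not_less intro: antisym)
  have "g ((1 - 1/2) * p + 1/2 * q) < g p"
    using strictly_convex_onD[OF conv in_S \<open>p \<noteq> q\<close>, of "1/2"] eq by simp
  moreover have "(1 - 1/2) * p + 1/2 * q \<in> S"
    by (rule is_interval_convex_comb[OF S in_S]) auto
  ultimately show False using p by (auto simp: is_arg_min_def)
qed

lemma minimizer_eqI:
  assumes "is_interval S" "strictly_convex_on S g" "is_arg_min g (\<lambda>y. y \<in> S) p"
  shows "minimizer g S = p"
  unfolding minimizer_def using assms by (blast intro: the_equality is_arg_min_unique)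

lemma is_arg_min_minimizer:
  assumes "is_interval S" "strictly_convex_on S g"
    and "compact S" "S \<noteq> {}" "continuous_on S g"
  shows "is_arg_min g (\<lambda>y. y \<in> S) (minimizer g S)"
proof -
  obtain p where "p \<in> S" "\<forall>y\<in>S. g p \<le> g y"
    using continuous_attains_inf[OF assms(3-5)] by blast
  hence "is_arg_min g (\<lambda>y. y \<in> S) p" by (auto simp: is_arg_min_def not_less)
  thus ?thesis using minimizer_eqI[OF assms(1,2)] by simp
qed

text \<open>The tangent of slope \<nu> supports \<open>g\<close> from below. Hence
  \<open>nabla_inv\<close> gives the minimizer of the local Lagrangian over the whole
  domain.\<close>

lemma nabla_inv_minimizes:
  assumes "is_interval D" "strictly_convex_on D g" "g differentiable_on D" "\<nu> \<in> nabla D g ` D"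
    and "y \<in> D"
  shows "g (nabla_inv D g \<nu>) - \<nu> * nabla_inv D g \<nu> \<le> g y - \<nu> * y"
proof -
  have "nabla_inv D g \<nu> \<in> D" "nabla D g (nabla_inv D g \<nu>) = \<nu>"
    unfolding nabla_inv_def using assms(4) by (auto intro: inv_into_into simp: f_inv_into_f)
  with above_tangent[OF assms(1-3) _ assms(5), of "nabla_inv D g \<nu>"]
  show ?thesis by (simp add: algebra_simps)
qed

text \<open>Moving from \<open>p\<close> towards the global minimizer \<open>c\<close> strictly
  decreases \<open>g\<close>, and \<open>m\<close> witnesses that such a move stays in
  \<open>S\<close>. This is the common core of the two one-sided lemmas below.\<close>

lemma constrained_min_between:
  assumes D: "strictly_convex_on D g" and S: "is_interval S" "S \<subseteq> D"
    and c: "c \<in> D" "\<And>y. y \<in> D \<Longrightarrow> g c \<le> g y"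
    and p: "is_arg_min g (\<lambda>y. y \<in> S) p"
    and m: "m \<in> S" "m \<in> open_segment p c \<or> m = c"
  shows "p = c"
proof (rule ccontr)
  assume "p \<noteq> c"
  have p': "p \<in> S" "p \<in> D" "g p \<le> g m"
    using p m(1) S(2) by (auto simp: is_arg_min_def not_less)
  from m(2) show False
  proof
    \<comment> \<open>The point \<open>c\<close> itself only yields \<open>g c \<le> g p\<close>;
      the midpoint gives a strict decrease.\<close>
    assume "m = c"
    hence cS: "c \<in> S" using m(1) by simp
    have "g ((1 - 1/2) * p + 1/2 * c) < g p"
      using strictly_convex_onD[OF D p'(2) c(1) \<open>p \<noteq> c\<close>, of "1/2"] c(2)[OF p'(2)] by simp
    moreover have "(1 - 1/2) * p + 1/2 * c \<in> S"
      by (rule is_interval_convex_comb[OF S(1) p'(1) cS]) auto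
    ultimately show False using p by (auto simp: is_arg_min_def)
  next
    assume "m \<in> open_segment p c"
    then obtain u where u: "0 < u" "u < 1" "m = (1 - u) * p + u * c"
      by (auto simp: in_segment)
    have "g m < (1 - u) * g p + u * g c"
      unfolding u(3) by (rule strictly_convex_onD[OF D p'(2) c(1) \<open>p \<noteq> c\<close> u(1,2)])
    also have "\<dots> \<le> (1 - u) * g p + u * g p"
      using c(2)[OF p'(2)] u by (intro add_left_mono mult_left_mono) auto
    finally show False using p'(3) by (simp add: algebra_simps)
  qed
qed

text \<open>If \<open>p < c\<close>, then \<open>min y c\<close> is a feasible point on the way from
  \<open>p\<close> to \<open>c\<close>. Read contrapositively, a constrained minimizer to the left
  of \<open>c\<close> is the largest point of \<open>S\<close>.\<close>

lemma constrained_min_ge: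
  assumes "strictly_convex_on D g" "is_interval S" "S \<subseteq> D"
    and c: "c \<in> D" "\<And>y. y \<in> D \<Longrightarrow> g c \<le> g y"
    and p: "is_arg_min g (\<lambda>y. y \<in> S) p" and y: "y \<in> S" "p < y"
  shows "c \<le> p"
proof (rule ccontr)
  assume "\<not> c \<le> p"
  have "p \<in> S" using p by (simp add: is_arg_min_def)
  hence "min y c \<in> S"
    using mem_is_interval_1_I[OF assms(2), of p y "min y c"] y \<open>\<not> c \<le> p\<close> by auto
  moreover have "min y c \<in> open_segment p c \<or> min y c = c"
    using y \<open>\<not> c \<le> p\<close> by (auto simp: open_segment_eq_real_ivl min_def)
  ultimately show False
    using constrained_min_between[OF assms(1-3) c p] \<open>\<not> c \<le> p\<close> by blast
qed

text \<open>Mirror image of \<open>constrained_min_ge\<close>: a constrained minimizer to the right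
  of \<open>c\<close> is the smallest point of \<open>S\<close>.\<close>

lemma constrained_min_le:
  assumes "strictly_convex_on D g" "is_interval S" "S \<subseteq> D"
    and c: "c \<in> D" "\<And>y. y \<in> D \<Longrightarrow> g c \<le> g y"
    and p: "is_arg_min g (\<lambda>y. y \<in> S) p" and y: "y \<in> S" "y < p"
  shows "p \<le> c"
proof (rule ccontr)
  assume "\<not> p \<le> c"
  have "p \<in> S" using p by (simp add: is_arg_min_def)
  hence "max y c \<in> S"
    using mem_is_interval_1_I[OF assms(2), of y p "max y c"] y \<open>\<not> p \<le> c\<close> by auto
  moreover have "max y c \<in> open_segment p c \<or> max y c = c"
    using y \<open>\<not> p \<le> c\<close> by (auto simp: open_segment_eq_real_ivl max_def)
  ultimately show False
    using constrained_min_between[OF assms(1-3) c p] \<open>\<not> p \<le> c\<close> by blast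
qed

section \<open>Base polyhedra and tight sets\<close>

text \<open>The equality covers the full ground set, so unions of sets can be handled without asking
  whether they are proper subsets.\<close>

lemma base_polyhedron_iff:
  "x \<in> base_polyhedron T r \<longleftrightarrow>
     (\<forall>X\<subseteq>{1..T}. sum x X \<le> r X) \<and> sum x {1..T} = r {1..T}"
proof
  assume x: "x \<in> base_polyhedron T r"
  hence le: "X \<subset> {1..T} \<Longrightarrow> sum x X \<le> r X" and eq: "sum x {1..T} = r {1..T}" for X
    unfolding base_polyhedron_def by blast+
  have "sum x X \<le> r X" if "X \<subseteq> {1..T}" for X
  proof (cases "X = {1..T}")
    case True
    show ?thesis unfolding True using eq by (rule eq_refl)
  next
    case False
    with that have "X \<subset> {1..T}" by (rule psubsetI)
    thus ?thesis by (rule le)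
  qed
  with eq show "(\<forall>X\<subseteq>{1..T}. sum x X \<le> r X) \<and> sum x {1..T} = r {1..T}"
    by blast
next
  assume "(\<forall>X\<subseteq>{1..T}. sum x X \<le> r X) \<and> sum x {1..T} = r {1..T}"
  thus "x \<in> base_polyhedron T r"
    unfolding base_polyhedron_def by blast
qed

lemma base_polyhedronD:
  assumes "x \<in> base_polyhedron T r"
  shows "X \<subseteq> {1..T} \<Longrightarrow> sum x X \<le> r X" "sum x {1..T} = r {1..T}"
  using assms base_polyhedron_iff by blast+

lemma base_polyhedron_cong:
  assumes "\<And>t. t \<in> {1..T} \<Longrightarrow> x t = y t"
  shows "x \<in> base_polyhedron T r \<longleftrightarrow> y \<in> base_polyhedron T r"
proof -
  have "sum x X = sum y X" if "X \<subseteq> {1..T}" for X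
    using that assms by (intro sum.cong) auto
  thus ?thesis unfolding base_polyhedron_iff by (simp cong: imp_cong)
qed

lemma base_polyhedron_convex_comb:
  assumes x: "x \<in> base_polyhedron T r" and y: "y \<in> base_polyhedron T r" and u: "0 \<le> u" "u \<le> 1"
  shows "(\<lambda>t. (1 - u) * x t + u * y t) \<in> base_polyhedron T r"
proof -
  have "sum (\<lambda>t. (1 - u) * x t + u * y t) X = (1 - u) * sum x X + u * sum y X" for X
    by (simp add: sum.distrib sum_distrib_left)
  moreover have "(1 - u) * sum x X + u * sum y X \<le> r X" if "X \<subseteq> {1..T}" for X
  proof -
    have "(1 - u) * sum x X + u * sum y X \<le> (1 - u) * r X + u * r X"
      using base_polyhedronD(1)[OF x that] base_polyhedronD(1)[OF y that] u
      by (intro add_mono mult_left_mono) auto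
    thus ?thesis by (simp add: algebra_simps)
  qed
  moreover have "(1 - u) * sum x {1..T} + u * sum y {1..T} = r {1..T}"
    using base_polyhedronD(2)[OF x] base_polyhedronD(2)[OF y] by (simp add: algebra_simps)
  ultimately show ?thesis unfolding base_polyhedron_iff by presburger
qed

text \<open>The lower bound arises by subtracting the constraint on the complement of
  \<open>t\<close> from the total.\<close>

lemma base_polyhedron_local_range:
  assumes x: "x \<in> base_polyhedron T r" and t: "t \<in> {1..T}"
  shows "x t \<in> local_range T r t"
proof -
  have "sum x {t} \<le> r {t}" "sum x ({1..T} - {t}) \<le> r ({1..T} - {t})" "sum x {1..T} = r {1..T}"
    using t base_polyhedronD(1)[OF x, of "{t}"] base_polyhedronD(1)[OF x, of "{1..T} - {t}"]
      base_polyhedronD(2)[OF x] by simp_all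
  moreover have "sum x {1..T} = x t + sum x ({1..T} - {t})"
    using t by (simp add: sum.remove)
  ultimately show ?thesis by (simp add: local_range_def)
qed

section \<open>Tight sets and exchanges between two coordinates\<close>

definition tight :: "nat \<Rightarrow> (nat set \<Rightarrow> real) \<Rightarrow> (nat \<Rightarrow> real) \<Rightarrow> nat set \<Rightarrow> bool" where
  "tight T r x X \<longleftrightarrow> X \<subseteq> {1..T} \<and> sum x X = r X"

text \<open>By submodularity the slacks of the union and the intersection have a sum of at most
  zero, while feasibility makes each nonnegative.\<close>

lemma tight_Un_Int:
  assumes "submodular_on T r" "x \<in> base_polyhedron T r" "tight T r x X" "tight T r x Y"
  shows "tight T r x (X \<union> Y) \<and> tight T r x (X \<inter> Y)"
proof -
  have XY: "X \<subseteq> {1..T}" "Y \<subseteq> {1..T}" and eq: "sum x X = r X" "sum x Y = r Y"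
    using assms(3,4) by (auto simp: tight_def)
  have "finite X" "finite Y" using XY finite_subset by blast+
  hence "sum x (X \<union> Y) + sum x (X \<inter> Y) = r X + r Y"
    using eq by (simp add: sum.union_inter)
  moreover have "r (X \<union> Y) + r (X \<inter> Y) \<le> r X + r Y"
    using assms(1) XY by (simp add: submodular_on_def)
  moreover have "sum x (X \<union> Y) \<le> r (X \<union> Y)" "sum x (X \<inter> Y) \<le> r (X \<inter> Y)"
    using base_polyhedronD(1)[OF assms(2)] XY by (auto simp: le_infI1)
  ultimately show ?thesis using XY by (auto simp: tight_def)
qed

text \<open>The exchange raises the sum only over sets containing \<open>s\<close> but not
  \<open>u\<close>. There are finitely many, none tight, so the smallest slack is a feasible
  step.\<close>

lemma exchange_feasible:
  assumes x: "x \<in> base_polyhedron T r" and su: "s \<in> {1..T}" "u \<in> {1..T}" "s \<noteq> u"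
    and no_tight: "\<forall>X. tight T r x X \<longrightarrow> s \<in> X \<longrightarrow> u \<in> X"
  shows "\<exists>\<epsilon>>0. x(s := x s + \<epsilon>, u := x u - \<epsilon>) \<in> base_polyhedron T r"
proof -
  define F where "F = {X. X \<subseteq> {1..T} \<and> s \<in> X \<and> u \<notin> X}"
  \<comment> \<open>The inserted 1 makes the set visibly nonempty, as \<open>Min\<close>
    requires.\<close>
  define \<epsilon> where "\<epsilon> = Min (insert 1 ((\<lambda>X. r X - sum x X) ` F))"
  have "finite F" by (simp add: F_def)
  have "0 < r X - sum x X" if "X \<in> F" for X
  proof -
    have "sum x X \<le> r X" using that base_polyhedronD(1)[OF x] by (simp add: F_def)
    moreover have "sum x X \<noteq> r X" using that no_tight unfolding F_def tight_def by blast
    ultimately show ?thesis by simp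
  qed
  hence pos: "\<epsilon> > 0" using \<open>finite F\<close> by (auto simp: \<epsilon>_def)
  have le: "\<epsilon> \<le> r X - sum x X" if "X \<in> F" for X
    using that \<open>finite F\<close> by (auto simp: \<epsilon>_def intro: Min_le)
  define x' where "x' = (\<lambda>i. x i + ((if i = s then \<epsilon> else 0) - (if i = u then \<epsilon> else 0)))"
  have x'_eq: "x' = x(s := x s + \<epsilon>, u := x u - \<epsilon>)" using su by (auto simp: x'_def)
  have sum_x': "sum x' X = sum x X + ((if s \<in> X then \<epsilon> else 0) - (if u \<in> X then \<epsilon> else 0))"
    if "X \<subseteq> {1..T}" for X
  proof -
    have "finite X" using that finite_subset by blast
    thus ?thesis by (simp add: x'_def sum.distrib sum_subtractf)
  qed
  have "x' \<in> base_polyhedron T r"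
    unfolding base_polyhedron_iff
  proof (intro conjI allI impI)
    fix X assume X: "X \<subseteq> {1..T}"
    have "sum x X \<le> r X" by (rule base_polyhedronD(1)[OF x X])
    thus "sum x' X \<le> r X" using sum_x'[OF X] le[of X] pos X by (auto simp: F_def)
  next
    show "sum x' {1..T} = r {1..T}" using sum_x'[of "{1..T}"] su base_polyhedronD(2)[OF x] by simp
  qed
  thus ?thesis using pos x'_eq by auto
qed

text \<open>Shifting mass to \<open>s\<close> from a later \<open>u\<close> keeps all earlier
  coordinates, so maximality forces a tight set that contains \<open>s\<close> and avoids
  \<open>u\<close>. Intersecting these over all later \<open>u\<close> gives
  \<open>Z\<close>.\<close>

lemma tight_of_not_increasable:
  assumes sub: "submodular_on T r" and x: "x \<in> base_polyhedron T r" and s: "s \<in> {1..T}"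
    and max: "\<forall>y\<in>base_polyhedron T r. (\<forall>i\<in>{1..<s}. y i = x i) \<longrightarrow> y s \<le> x s"
  shows "\<exists>Z. tight T r x Z \<and> s \<in> Z \<and> Z \<subseteq> {1..s}"
proof -
  have ex: "\<exists>Z. tight T r x Z \<and> s \<in> Z \<and> u \<notin> Z" if u: "u \<in> {s<..T}" for u
  proof (rule ccontr)
    assume "\<not> ?thesis"
    hence no_tight: "\<forall>Z. tight T r x Z \<longrightarrow> s \<in> Z \<longrightarrow> u \<in> Z" by blast
    have u': "u \<in> {1..T}" "s \<noteq> u" using s u by auto
    obtain \<epsilon> where "\<epsilon> > 0" and feasible: "x(s := x s + \<epsilon>, u := x u - \<epsilon>) \<in> base_polyhedron T r"
      using exchange_feasible[OF x s u' no_tight] by (elim exE conjE)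
    have "(x(s := x s + \<epsilon>, u := x u - \<epsilon>)) s \<le> x s"
      by (rule max[THEN bspec, OF feasible, THEN mp]) (use u in simp)
    with u \<open>\<epsilon> > 0\<close> show False by simp
  qed
  have "\<exists>Z. tight T r x Z \<and> s \<in> Z \<and> Z \<inter> U = {}" if "finite U" "U \<subseteq> {s<..T}" for U
    using that
  proof (induction U)
    case empty
    have "tight T r x {1..T}" using base_polyhedronD(2)[OF x] by (simp add: tight_def)
    thus ?case using s by blast
  next
    case (insert u U)
    have U: "U \<subseteq> {s<..T}" and u: "u \<in> {s<..T}" using insert.prems by simp_all
    obtain Z where Z: "tight T r x Z" "s \<in> Z" "Z \<inter> U = {}" using insert.IH[OF U] by blast
    obtain Z' where Z': "tight T r x Z'" "s \<in> Z'" "u \<notin> Z'" using ex[OF u] by blast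
    have "tight T r x (Z \<inter> Z')" using tight_Un_Int[OF sub x Z(1) Z'(1)] by blast
    moreover have "s \<in> Z \<inter> Z'" "(Z \<inter> Z') \<inter> insert u U = {}" using Z(2,3) Z'(2,3) by blast+
    ultimately show ?case by blast
  qed
  from this[OF finite_greaterThanAtMost order_refl]
  obtain Z where Z: "tight T r x Z" "s \<in> Z" "Z \<inter> {s<..T} = {}" by blast
  have "Z \<subseteq> {1..s}"
  proof
    fix i assume "i \<in> Z"
    hence "i \<in> {1..T}" "i \<notin> {s<..T}" using Z(1,3) unfolding tight_def by blast+
    thus "i \<in> {1..s}" by auto
  qed
  thus ?thesis using Z by blast
qed

text \<open>Dual argument: shifting mass from \<open>t\<close> to a later \<open>u\<close> is
  blocked by a tight set that contains \<open>u\<close> and avoids \<open>t\<close>, and these sets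
  are united. The union starts from the empty set, tight because \<open>r {} = 0\<close>.\<close>

lemma tight_of_not_decreasable:
  assumes sub: "submodular_on T r" and "r {} = 0" and x: "x \<in> base_polyhedron T r"
    and t: "t \<in> {1..T}"
    and min: "\<forall>y\<in>base_polyhedron T r. (\<forall>i\<in>{1..<t}. y i = x i) \<longrightarrow> x t \<le> y t"
  shows "\<exists>W. tight T r x W \<and> t \<notin> W \<and> {t<..T} \<subseteq> W"
proof -
  have ex: "\<exists>W. tight T r x W \<and> t \<notin> W \<and> u \<in> W" if u: "u \<in> {t<..T}" for u
  proof (rule ccontr)
    assume "\<not> ?thesis"
    hence no_tight: "\<forall>W. tight T r x W \<longrightarrow> u \<in> W \<longrightarrow> t \<in> W" by blast
    have u': "u \<in> {1..T}" "u \<noteq> t" using t u by auto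
    obtain \<epsilon> where "\<epsilon> > 0" and feasible: "x(u := x u + \<epsilon>, t := x t - \<epsilon>) \<in> base_polyhedron T r"
      using exchange_feasible[OF x u'(1) t u'(2) no_tight] by (elim exE conjE)
    have "x t \<le> (x(u := x u + \<epsilon>, t := x t - \<epsilon>)) t"
      by (rule min[THEN bspec, OF feasible, THEN mp]) (use u in simp)
    with u \<open>\<epsilon> > 0\<close> show False by simp
  qed
  have "\<exists>W. tight T r x W \<and> t \<notin> W \<and> U \<subseteq> W" if "finite U" "U \<subseteq> {t<..T}" for U
    using that
  proof (induction U)
    case empty
    have "tight T r x {}" using \<open>r {} = 0\<close> by (simp add: tight_def)
    thus ?case by blast
  next
    case (insert u U)
    have U: "U \<subseteq> {t<..T}" and u: "u \<in> {t<..T}" using insert.prems by simp_all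
    obtain W where W: "tight T r x W" "t \<notin> W" "U \<subseteq> W" using insert.IH[OF U] by blast
    obtain W' where W': "tight T r x W'" "t \<notin> W'" "u \<in> W'" using ex[OF u] by blast
    have "tight T r x (W \<union> W')" using tight_Un_Int[OF sub x W(1) W'(1)] by blast
    moreover have "t \<notin> W \<union> W'" "insert u U \<subseteq> W \<union> W'" using W(2,3) W'(2,3) by blast+
    ultimately show ?case by blast
  qed
  from this[OF finite_greaterThanAtMost order_refl] show ?thesis .
qed

lemma base_le_of_blocked:
  assumes sub: "submodular_on T r" and "r {} = 0"
    and x: "x \<in> base_polyhedron T r" and y: "y \<in> base_polyhedron T r" and t: "t \<in> {1..T}"
    and below: "\<forall>z\<in>base_polyhedron T r. (\<forall>i\<in>{1..<t}. z i = x i) \<longrightarrow> x t \<le> z t"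
    and above: "\<And>s. s \<in> {1..<t} \<Longrightarrow> x s < y s \<Longrightarrow>
                  \<forall>z\<in>base_polyhedron T r. (\<forall>i\<in>{1..<s}. z i = x i) \<longrightarrow> z s \<le> x s"
  shows "x t \<le> y t"
proof (rule ccontr)
  assume "\<not> x t \<le> y t"
  obtain W where W: "tight T r x W" "t \<notin> W" "{t<..T} \<subseteq> W"
    using tight_of_not_decreasable[OF sub \<open>r {} = 0\<close> x t below] by blast
  \<comment> \<open>Enlarge \<open>W\<close> by one tight set for each earlier stage where
    \<open>x\<close> is behind \<open>y\<close>. Such a set lies in \<open>{1..s}\<close> with
    \<open>s < t\<close>, so \<open>t\<close> stays outside.\<close>
  have "\<exists>V. tight T r x V \<and> t \<notin> V \<and> W \<union> S \<subseteq> V"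
    if "finite S" "S \<subseteq> {s \<in> {1..<t}. x s < y s}" for S
    using that
  proof (induction S)
    case empty
    thus ?case using W by blast
  next
    case (insert s S)
    have S: "S \<subseteq> {s \<in> {1..<t}. x s < y s}" and s: "s \<in> {1..<t}" "x s < y s" "s \<in> {1..T}"
      using insert.prems t by auto
    obtain V where V: "tight T r x V" "t \<notin> V" "W \<union> S \<subseteq> V" using insert.IH[OF S] by blast
    obtain Z where Z: "tight T r x Z" "s \<in> Z" "Z \<subseteq> {1..s}"
      using tight_of_not_increasable[OF sub x s(3) above[OF s(1,2)]] by blast
    have "tight T r x (V \<union> Z)" using tight_Un_Int[OF sub x V(1) Z(1)] by blast
    moreover have "t \<notin> Z" using Z(3) s(1) by auto
    moreover have "W \<union> insert s S \<subseteq> V \<union> Z" using V(3) Z(2) by blast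
    ultimately show ?case using V(2) by blast
  qed
  from this[OF _ order_refl]
  obtain V where V: "tight T r x V" "t \<notin> V" "W \<union> {s \<in> {1..<t}. x s < y s} \<subseteq> V" by auto
  have le: "y i \<le> x i" if "i \<in> {1..T} - V" for i
  proof -
    have "i \<notin> {t<..T}" "i \<notin> {s \<in> {1..<t}. x s < y s}" using that V(3) W(3) by blast+
    thus ?thesis using that \<open>\<not> x t \<le> y t\<close> by (cases "i = t") auto
  qed
  have "sum y ({1..T} - V) < sum x ({1..T} - V)"
  proof (rule sum_strict_mono_ex1)
    show "\<exists>i\<in>{1..T} - V. y i < x i"
      using t V(2) \<open>\<not> x t \<le> y t\<close> by (intro bexI[of _ t]) auto
  qed (use le in blast)+
  moreover have split: "sum g {1..T} = sum g ({1..T} - V) + sum g V" for g :: "nat \<Rightarrow> real"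
    using V(1) by (intro sum.subset_diff) (simp_all add: tight_def)
  \<comment> \<open>Tightness gives \<open>x\<close> at least as much mass on \<open>V\<close> as
    \<open>y\<close>, and it has strictly more off \<open>V\<close>, although the totals
    agree.\<close>
  moreover have "sum y V \<le> r V" "sum x V = r V" "sum x {1..T} = r {1..T}" "sum y {1..T} = r {1..T}"
    using V(1) base_polyhedronD[OF x] base_polyhedronD[OF y] by (auto simp: tight_def)
  ultimately show False using split[of x] split[of y] by linarith
qed

section \<open>The online solution\<close>

lemma projected_range_cong:
  assumes "\<And>s. s \<in> {1..<t} \<Longrightarrow> z s = z' s"
  shows "projected_range T r z t = projected_range T r z' t"
  using assms unfolding projected_range_def by (metis (mono_tags, lifting))

lemma projected_range_subset:
  assumes "t \<in> {1..T}"
  shows "projected_range T r z t \<subseteq> local_range T r t"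
  using base_polyhedron_local_range assms by (auto simp: projected_range_def)

lemma is_interval_projected_range: "is_interval (projected_range T r z t)"
  unfolding is_interval_convex_1 convex_alt
proof (intro ballI allI impI)
  fix p q u :: real
  assume pq: "p \<in> projected_range T r z t" "q \<in> projected_range T r z t" and "0 \<le> u \<and> u \<le> 1"
  then obtain x y where x: "x \<in> base_polyhedron T r" "\<forall>s\<in>{1..<t}. x s = z s" "x t = p"
    and y: "y \<in> base_polyhedron T r" "\<forall>s\<in>{1..<t}. y s = z s" "y t = q"
    unfolding projected_range_def by blast
  have "(\<lambda>t. (1 - u) * x t + u * y t) \<in> base_polyhedron T r"
    using x y \<open>0 \<le> u \<and> u \<le> 1\<close> by (intro base_polyhedron_convex_comb) auto
  moreover have "\<forall>s\<in>{1..<t}. (1 - u) * x s + u * y s = z s"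
    using x(2) y(2) by (simp add: algebra_simps)
  ultimately show "(1 - u) *\<^sub>R p + u *\<^sub>R q \<in> projected_range T r z t"
    using x(3) y(3) unfolding projected_range_def by auto
qed

text \<open>The feasible completions form a closed part of a product of compact intervals, and the
  range is its image under a continuous coordinate map.\<close>

lemma compact_projected_range:
  assumes t: "t \<in> {1..T}"
  shows "compact (projected_range T r z t)"
proof -
  \<comment> \<open>Vectors are functions on all of \<open>nat\<close>; coordinates outside
    \<open>{1..T}\<close> are pinned to 0 to obtain a compact product.\<close>
  define I where "I i = (if i \<in> {1..T} then local_range T r i else {0})" for i
  define K where "K = PiE UNIV I"
  define A where "A = {x. (\<forall>X\<in>Pow {1..T}. sum x X \<le> r X) \<and> sum x {1..T} = r {1..T}
                          \<and> (\<forall>s\<in>{1..<t}. x s = z s)}"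
  have "compactin (product_topology (\<lambda>i. euclidean) UNIV) K"
    unfolding K_def compactin_PiE by (simp add: I_def local_range_def)
  hence "compact K" by (simp add: euclidean_product_topology)
  moreover have "closed A"
    unfolding A_def Ball_def
    by (intro closed_Collect_conj closed_Collect_all closed_Collect_imp closed_Collect_le
        closed_Collect_eq continuous_intros continuous_on_product_coordinates open_Collect_const)
  ultimately have "compact (A \<inter> K)" by (simp add: closed_Int_compact)
  hence "compact ((\<lambda>x. x t) ` (A \<inter> K))"
    by (rule compact_continuous_image[rotated])
       (metis continuous_on_product_coordinates continuous_on_subset subset_UNIV)
  moreover have "(\<lambda>x. x t) ` (A \<inter> K) = projected_range T r z t"
  proof
    show "(\<lambda>x. x t) ` (A \<inter> K) \<subseteq> projected_range T r z t"
      by (auto simp: A_def projected_range_def base_polyhedron_iff)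
    show "projected_range T r z t \<subseteq> (\<lambda>x. x t) ` (A \<inter> K)"
    proof
      fix p assume "p \<in> projected_range T r z t"
      then obtain x where x: "x \<in> base_polyhedron T r" "\<forall>s\<in>{1..<t}. x s = z s" "x t = p"
        unfolding projected_range_def by blast
      define x' where "x' i = (if i \<in> {1..T} then x i else 0)" for i
      have "x' \<in> base_polyhedron T r"
        using x(1) base_polyhedron_cong[of T x' x r] by (simp add: x'_def)
      moreover from this have "x' \<in> K"
        using base_polyhedron_local_range[of x' T r] by (auto simp: K_def I_def x'_def)
      moreover have "\<forall>s\<in>{1..<t}. x' s = z s" "x' t = p" using x t by (auto simp: x'_def)
      ultimately have "x' \<in> A \<inter> K" "x' t = p"
        by (auto simp: A_def base_polyhedron_iff)
      thus "p \<in> (\<lambda>x. x t) ` (A \<inter> K)" by blast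
    qed
  qed
  ultimately show ?thesis by simp
qed

lemma strictly_convex_local_lagrangian:
  assumes "I_sub T r D f" "t \<in> {1..T}"
  shows "strictly_convex_on (D t) (local_lagrangian T f \<mu> l t)"
  using assms strictly_convex_on_diff_linear unfolding I_sub_def local_lagrangian_def by blast

text \<open>Justifies the definite description in \<open>minimizer\<close>: compactness and
  continuity give existence, strict convexity gives uniqueness.\<close>

lemma is_arg_min_minimizer_lagrangian:
  assumes inst: "I_sub T r D f" and t: "t \<in> {1..T}"
    and S: "is_interval S" "compact S" "S \<noteq> {}" "S \<subseteq> D t"
  shows "is_arg_min (local_lagrangian T f \<mu> l t) (\<lambda>y. y \<in> S)
           (minimizer (local_lagrangian T f \<mu> l t) S)"
proof (rule is_arg_min_minimizer[OF S(1) _ S(2,3)])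
  show "strictly_convex_on S (local_lagrangian T f \<mu> l t)"
    using strictly_convex_on_subset[OF strictly_convex_local_lagrangian[OF inst t] S(4)] .
  have "continuous_on (D t) (f t)"
    using inst t unfolding I_sub_def by (blast intro: differentiable_imp_continuous_on)
  thus "continuous_on S (local_lagrangian T f \<mu> l t)"
    unfolding local_lagrangian_def
    by (intro continuous_intros) (rule continuous_on_subset[OF _ S(4)])
qed

text \<open>Removes the zero padding of the recursion, since only coordinates before
  \<open>t\<close> are inspected.\<close>

lemma online_solution_eq:
  "online_solution T r f \<mu> l t =
     minimizer (local_lagrangian T f \<mu> l t) (projected_range T r (online_solution T r f \<mu> l) t)"
  by (subst online_solution.simps, rule arg_cong[where f = "minimizer _"])
     (rule projected_range_cong, simp)

lemma online_solution_arg_min_extensible: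
  assumes inst: "I_sub T r D f" and x: "x \<in> base_polyhedron T r" and t: "t \<in> {1..T}"
    and agree: "\<forall>s\<in>{1..<t}. x s = online_solution T r f \<mu> l s"
  shows "is_arg_min (local_lagrangian T f \<mu> l t)
           (\<lambda>y. y \<in> projected_range T r (online_solution T r f \<mu> l) t)
           (online_solution T r f \<mu> l t)"
proof -
  let ?P = "projected_range T r (online_solution T r f \<mu> l) t"
  have "x t \<in> ?P" using x agree by (auto simp: projected_range_def)
  moreover have "?P \<subseteq> D t"
    using projected_range_subset[OF t] inst t unfolding I_sub_def by blast
  ultimately show ?thesis
    using is_arg_min_minimizer_lagrangian[OF inst t is_interval_projected_range
        compact_projected_range[OF t]] online_solution_eq
    by (metis empty_iff)
qed

text \<open>Each decision is taken from a projected range and so comes with a feasible completion,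
  which keeps the next projected range nonempty.\<close>

lemma online_solution_feasible:
  assumes inst: "I_sub T r D f" and "base_polyhedron T r \<noteq> {}"
  shows "online_solution T r f \<mu> l \<in> base_polyhedron T r"
proof -
  let ?z = "online_solution T r f \<mu> l"
  \<comment> \<open>The interval \<open>{1..<Suc t}\<close> holds the first \<open>t\<close> stages;
    for \<open>t = 0\<close> any feasible vector works.\<close>
  have "\<exists>x\<in>base_polyhedron T r. \<forall>s\<in>{1..<Suc t}. x s = ?z s" if "t \<le> T" for t
    using that
  proof (induction t)
    case 0
    thus ?case using assms(2) by auto
  next
    case (Suc t)
    then obtain x where x: "x \<in> base_polyhedron T r" "\<forall>s\<in>{1..<Suc t}. x s = ?z s" by auto
    have "?z (Suc t) \<in> projected_range T r ?z (Suc t)"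
      using online_solution_arg_min_extensible[OF inst x(1) _ x(2)] Suc.prems
      by (simp add: is_arg_min_def)
    then obtain y where "y \<in> base_polyhedron T r" "\<forall>s\<in>{1..<Suc t}. y s = ?z s" "y (Suc t) = ?z (Suc t)"
      unfolding projected_range_def by blast
    thus ?case by (intro bexI[of _ y]) (auto simp: less_Suc_eq)
  qed
  then obtain x where "x \<in> base_polyhedron T r" "\<forall>s\<in>{1..<Suc T}. x s = ?z s" by blast
  thus ?thesis using base_polyhedron_cong[of T x ?z r] by auto
qed

lemma online_solution_arg_min:
  assumes "I_sub T r D f" "base_polyhedron T r \<noteq> {}" "t \<in> {1..T}"
  shows "is_arg_min (local_lagrangian T f \<mu> l t)
           (\<lambda>y. y \<in> projected_range T r (online_solution T r f \<mu> l) t)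
           (online_solution T r f \<mu> l t)"
  using online_solution_arg_min_extensible[OF assms(1) online_solution_feasible] assms by blast

lemma local_solution_arg_min:
  assumes inst: "I_sub T r D f" and "base_polyhedron T r \<noteq> {}" and t: "t \<in> {1..T}"
  shows "is_arg_min (local_lagrangian T f \<mu> l t) (\<lambda>y. y \<in> local_range T r t)
           (local_solution T r f \<mu> l t)"
  unfolding local_solution_def
proof (rule is_arg_min_minimizer_lagrangian[OF inst t])
  show "local_range T r t \<noteq> {}" using base_polyhedron_local_range[OF _ t] assms(2) by blast
  show "local_range T r t \<subseteq> D t" using inst t unfolding I_sub_def by blast
qed (simp_all add: local_range_def is_interval_cc)

text \<open>The local solutions form a feasible vector, so once the earlier decisions agree, the
  local solution lies in the projected range. It minimizes over the larger local range, hence also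
  here.\<close>

lemma online_solution_optimal_multipliers:
  assumes inst: "I_sub T r D f" and opt: "optimal_multipliers T r f \<mu> l" and "t \<in> {1..T}"
  shows "online_solution T r f \<mu> l t = local_solution T r f \<mu> l t"
  using \<open>t \<in> {1..T}\<close>
proof (induction t rule: less_induct)
  case (less t)
  let ?x = "local_solution T r f \<mu> l" and ?z = "online_solution T r f \<mu> l"
  let ?P = "projected_range T r ?z t"
  have x: "?x \<in> base_polyhedron T r"
    using opt by (simp add: optimal_multipliers_def optimal_solution_def is_arg_min_def)
  hence ne: "base_polyhedron T r \<noteq> {}" by blast
  have "\<forall>s\<in>{1..<t}. ?x s = ?z s" using less by auto
  hence "?x t \<in> ?P" using x by (auto simp: projected_range_def)
  hence "is_arg_min (local_lagrangian T f \<mu> l t) (\<lambda>y. y \<in> ?P) (?x t)"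
    using local_solution_arg_min[OF inst ne less.prems, of \<mu> l] projected_range_subset[OF less.prems]
    unfolding is_arg_min_def by blast
  moreover have "?P \<subseteq> D t"
    using projected_range_subset[OF less.prems] inst less.prems unfolding I_sub_def by blast
  ultimately show ?case
    using online_solution_eq minimizer_eqI[OF is_interval_projected_range]
      strictly_convex_on_subset[OF strictly_convex_local_lagrangian[OF inst less.prems]] by metis
qed

section \<open>Comparing smaller multipliers with optimal ones\<close>

lemma nu_antimono:
  assumes "\<And>X. X \<in> multiplier_sets T \<Longrightarrow> \<mu>1 X \<le> \<mu>2 X" "l1 \<le> l2"
  shows "nu T \<mu>2 l2 t \<le> nu T \<mu>1 l1 t"
proof -
  have "(\<Sum>X\<in>{X \<in> multiplier_sets T. t \<in> X}. \<mu>1 X) \<le> (\<Sum>X\<in>{X \<in> multiplier_sets T. t \<in> X}. \<mu>2 X)"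
    using assms(1) by (intro sum_mono) auto
  thus ?thesis using assms(2) by (simp add: nu_def)
qed

text \<open>Index 1 marks the optimal multipliers and index 2 the smaller ones. The bound holds for
  each stage separately, so summing it is enough.\<close>

lemma online_stage_cost_bound:
  assumes inst: "I_sub T r D f" and opt: "optimal_multipliers T r f \<mu>1 l1"
    and \<mu>_le: "\<And>X. X \<in> multiplier_sets T \<Longrightarrow> \<mu>2 X \<le> \<mu>1 X" and l_le: "l2 \<le> l1"
    and range1: "\<And>t. t \<in> {1..T} \<Longrightarrow> nu T \<mu>1 l1 t \<in> nabla (D t) (f t) ` D t"
    and range2: "\<And>t. t \<in> {1..T} \<Longrightarrow> nu T \<mu>2 l2 t \<in> nabla (D t) (f t) ` D t"
    and t: "t \<in> {1..T}"
  shows "f t (online_solution T r f \<mu>2 l2 t) - f t (online_solution T r f \<mu>1 l1 t)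
       \<le> f t (nabla_inv (D t) (f t) (nu T \<mu>2 l2 t)) - f t (nabla_inv (D t) (f t) (nu T \<mu>1 l1 t))"
proof -
  define x where "x = online_solution T r f \<mu>2 l2"
  define y where "y = local_solution T r f \<mu>1 l1"
  \<comment> \<open>\<open>c1\<close> and \<open>c2\<close> are the minimizers of the two local
    Lagrangians over the whole domain.\<close>
  define c1 where "c1 s = nabla_inv (D s) (f s) (nu T \<mu>1 l1 s)" for s
  define c2 where "c2 s = nabla_inv (D s) (f s) (nu T \<mu>2 l2 s)" for s
  have sub: "submodular_on T r" "r {} = 0" using inst by (auto simp: I_sub_def)
  have Ds: "is_interval (D s)" "strictly_convex_on (D s) (f s)" "f s differentiable_on D s"
    "local_range T r s \<subseteq> D s" if "s \<in> {1..T}" for s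
    using inst that by (auto simp: I_sub_def)
  have yB: "y \<in> base_polyhedron T r"
    using opt by (simp add: y_def optimal_multipliers_def optimal_solution_def is_arg_min_def)
  hence ne: "base_polyhedron T r \<noteq> {}" by blast
  have xB: "x \<in> base_polyhedron T r"
    unfolding x_def by (rule online_solution_feasible[OF inst ne])
  have x_min: "is_arg_min (local_lagrangian T f \<mu>2 l2 s) (\<lambda>q. q \<in> projected_range T r x s) (x s)"
    and y_min: "is_arg_min (local_lagrangian T f \<mu>1 l1 s) (\<lambda>q. q \<in> local_range T r s) (y s)"
    if "s \<in> {1..T}" for s
    unfolding x_def y_def
    by (rule online_solution_arg_min[OF inst ne that], rule local_solution_arg_min[OF inst ne that])
  have cD: "c1 s \<in> D s" "c2 s \<in> D s" if "s \<in> {1..T}" for s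
    using range1[OF that] range2[OF that] by (simp_all add: c1_def c2_def nabla_inv_def inv_into_into)
  have c1_min: "local_lagrangian T f \<mu>1 l1 s (c1 s) \<le> local_lagrangian T f \<mu>1 l1 s q"
    and c2_min: "local_lagrangian T f \<mu>2 l2 s (c2 s) \<le> local_lagrangian T f \<mu>2 l2 s q"
    if "s \<in> {1..T}" "q \<in> D s" for s q
    unfolding local_lagrangian_def c1_def c2_def
    using nabla_inv_minimizes[OF Ds(1-3)[OF that(1)] range1[OF that(1)] that(2)]
      nabla_inv_minimizes[OF Ds(1-3)[OF that(1)] range2[OF that(1)] that(2)] by simp_all
  have c_le: "c1 s \<le> c2 s" if "s \<in> {1..T}" for s
    unfolding c1_def c2_def
    by (rule nabla_inv_mono[OF Ds(1-3)[OF that] range1[OF that] range2[OF that]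
          nu_antimono[OF \<mu>_le l_le]])
  have P_sub: "projected_range T r x s \<subseteq> D s" if "s \<in> {1..T}" for s
    using projected_range_subset[OF that] Ds(4)[OF that] by blast
  have x_loc: "x s \<in> local_range T r s" if "s \<in> {1..T}" for s
    using base_polyhedron_local_range[OF xB that] .
  \<comment> \<open>A minimizer \<open>x t\<close> beyond \<open>c2 t\<close> must be the left end
    of its projected range.\<close>
  have x_le: "x t \<le> y t" if "c2 t < x t"
  proof (rule base_le_of_blocked[OF sub xB yB t]; intro ballI impI)
    fix z assume z: "z \<in> base_polyhedron T r" "\<forall>i\<in>{1..<t}. z i = x i"
    hence "z t \<in> projected_range T r x t" by (auto simp: projected_range_def)
    with constrained_min_le[OF strictly_convex_local_lagrangian[OF inst t]
        is_interval_projected_range P_sub[OF t] cD(2)[OF t] c2_min[OF t] x_min[OF t] this] that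
    show "x t \<le> z t" by linarith
  next
    fix s z assume s: "s \<in> {1..<t}" "x s < y s"
      and z: "z \<in> base_polyhedron T r" "\<forall>i\<in>{1..<s}. z i = x i"
    have sT: "s \<in> {1..T}" using s(1) t by auto
    \<comment> \<open>Here \<open>y s\<close> is not the left end of the local range, as
      \<open>x s\<close> lies below it. So \<open>x s < y s \<le> c1 s \<le> c2 s\<close>, and
      \<open>x s\<close> is the right end of its projected range.\<close>
    have "y s \<le> c1 s"
      using constrained_min_le[OF strictly_convex_local_lagrangian[OF inst sT] _ Ds(4)[OF sT]
          cD(1)[OF sT] c1_min[OF sT] y_min[OF sT] x_loc[OF sT] s(2)]
      by (simp add: local_range_def is_interval_cc)
    hence "x s < c2 s" using s(2) c_le[OF sT] by simp
    moreover have "z s \<in> projected_range T r x s" using z by (auto simp: projected_range_def)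
    ultimately show "z s \<le> x s"
      using constrained_min_ge[OF strictly_convex_local_lagrangian[OF inst sT]
        is_interval_projected_range P_sub[OF sT] cD(2)[OF sT] c2_min[OF sT] x_min[OF sT], of "z s"]
      by linarith
  qed
  have mono: "f t p \<le> f t q" if "p \<in> D t" "q \<in> D t" "p \<le> q" for p q
    using inst t that by (auto simp: I_sub_def mono_on_def)
  have in_D: "x t \<in> D t" "y t \<in> D t"
    using x_loc[OF t] base_polyhedron_local_range[OF yB t] Ds(4)[OF t] by blast+
  have "f t (x t) - f t (y t) \<le> f t (c2 t) - f t (c1 t)"
  proof (cases "x t \<le> y t")
    case True
    \<comment> \<open>Monotonicity makes the left side nonpositive and the right side
      nonnegative.\<close>
    thus ?thesis using mono[OF in_D] mono[OF cD[OF t] c_le[OF t]] by simp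
  next
    case False
    hence "x t \<le> c2 t" using x_le by linarith
    \<comment> \<open>Now \<open>x t\<close> is a point of the local range above \<open>y t\<close>,
      so \<open>y t\<close> cannot lie left of \<open>c1 t\<close>.\<close>
    moreover have "c1 t \<le> y t"
      using constrained_min_ge[OF strictly_convex_local_lagrangian[OF inst t] _ Ds(4)[OF t]
          cD(1)[OF t] c1_min[OF t] y_min[OF t] x_loc[OF t]] False
      by (auto simp: local_range_def is_interval_cc)
    ultimately have "f t (x t) \<le> f t (c2 t)" "f t (c1 t) \<le> f t (y t)"
      using mono[OF in_D(1) cD(2)[OF t]] mono[OF cD(1)[OF t] in_D(2)] by simp_all
    thus ?thesis by simp
  qed
  thus ?thesis
    using online_solution_optimal_multipliers[OF inst opt t] by (simp add: x_def y_def c1_def c2_def)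
qed

theorem corollary1:
  fixes T :: nat
    and r :: "nat set \<Rightarrow> real"
    and D :: "nat \<Rightarrow> real set"
    and f fbar :: "nat \<Rightarrow> real \<Rightarrow> real"
    and a b :: "nat \<Rightarrow> real"
    and \<mu>_opt \<mu>_hat :: "nat set \<Rightarrow> real"
    and l_opt l_hat :: real
  assumes inst: "I_sub T r D f"
    and a_pos: "\<And>t. t \<in> {1..T} \<Longrightarrow> a t > 0"
    and fbar_mono: "\<And>t. t \<in> {1..T} \<Longrightarrow> mono_on (rescaled_domain (a t) (b t) (D t)) (fbar t)"
    and fbar_convex: "\<And>t. t \<in> {1..T} \<Longrightarrow> strictly_convex_on (rescaled_domain (a t) (b t) (D t)) (fbar t)"
    and fbar_diff: "\<And>t. t \<in> {1..T} \<Longrightarrow> fbar t differentiable_on rescaled_domain (a t) (b t) (D t)"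
    and f_eq: "\<And>t x. t \<in> {1..T} \<Longrightarrow> x \<in> D t \<Longrightarrow> f t x = a t * fbar t (x / a t + b t)"
    and opt: "optimal_multipliers T r f \<mu>_opt l_opt"
    and \<mu>_le: "\<And>X. X \<in> multiplier_sets T \<Longrightarrow> \<mu>_hat X \<le> \<mu>_opt X"
    and l_le: "l_hat \<le> l_opt"
    and range_hat: "\<And>t. t \<in> {1..T} \<Longrightarrow> nu T \<mu>_hat l_hat t \<in> nabla (D t) (f t) ` D t"
    and range_opt: "\<And>t. t \<in> {1..T} \<Longrightarrow> nu T \<mu>_opt l_opt t \<in> nabla (D t) (f t) ` D t"
  shows "(\<Sum>t\<in>{1..T}. f t (nabla_inv (D t) (f t) (nu T \<mu>_hat l_hat t)))
           - (\<Sum>t\<in>{1..T}. f t (nabla_inv (D t) (f t) (nu T \<mu>_opt l_opt t)))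
         = (\<Sum>t\<in>{1..T}. a t * fbar t (nabla_inv (rescaled_domain (a t) (b t) (D t)) (fbar t) (nu T \<mu>_hat l_hat t)))
           - (\<Sum>t\<in>{1..T}. a t * fbar t (nabla_inv (rescaled_domain (a t) (b t) (D t)) (fbar t) (nu T \<mu>_opt l_opt t)))
       \<and> (\<Sum>t\<in>{1..T}. f t (online_solution T r f \<mu>_hat l_hat t))
           - (\<Sum>t\<in>{1..T}. f t (online_solution T r f \<mu>_opt l_opt t))
         \<le> (\<Sum>t\<in>{1..T}. a t * fbar t (nabla_inv (rescaled_domain (a t) (b t) (D t)) (fbar t) (nu T \<mu>_hat l_hat t)))
           - (\<Sum>t\<in>{1..T}. a t * fbar t (nabla_inv (rescaled_domain (a t) (b t) (D t)) (fbar t) (nu T \<mu>_opt l_opt t)))"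
proof -
  let ?c = "\<lambda>\<mu> l t. nabla_inv (D t) (f t) (nu T \<mu> l t)"
  let ?cbar = "\<lambda>\<mu> l t. nabla_inv (rescaled_domain (a t) (b t) (D t)) (fbar t) (nu T \<mu> l t)"
  \<comment> \<open>The rescaling sends the minimizer for \<open>f t\<close> to that for
    \<open>fbar t\<close>, so the costs agree term by term, for either pair of multipliers.\<close>
  have cost_eq: "f t (?c \<mu> l t) = a t * fbar t (?cbar \<mu> l t)"
    if t: "t \<in> {1..T}" and \<nu>: "nu T \<mu> l t \<in> nabla (D t) (f t) ` D t" for t \<mu> l
  proof -
    have D: "is_interval (D t)" "interior (D t) \<noteq> {}" "strictly_convex_on (D t) (f t)"
      "f t differentiable_on D t"
      using inst t by (auto simp: I_sub_def)
    have "?cbar \<mu> l t = ?c \<mu> l t / a t + b t"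
      by (rule nabla_inv_rescaled[OF D a_pos[OF t] fbar_diff[OF t] f_eq[OF t] \<nu>])
    moreover have "?c \<mu> l t \<in> D t"
      using \<nu> by (auto simp: nabla_inv_def intro: inv_into_into)
    ultimately show ?thesis using f_eq[OF t] by simp
  qed
  have eq_hat: "(\<Sum>t\<in>{1..T}. a t * fbar t (?cbar \<mu>_hat l_hat t)) = (\<Sum>t\<in>{1..T}. f t (?c \<mu>_hat l_hat t))"
    and eq_opt: "(\<Sum>t\<in>{1..T}. a t * fbar t (?cbar \<mu>_opt l_opt t)) = (\<Sum>t\<in>{1..T}. f t (?c \<mu>_opt l_opt t))"
    using cost_eq range_hat range_opt by simp_all
  have "(\<Sum>t\<in>{1..T}. f t (online_solution T r f \<mu>_hat l_hat t) - f t (online_solution T r f \<mu>_opt l_opt t))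
      \<le> (\<Sum>t\<in>{1..T}. f t (?c \<mu>_hat l_hat t) - f t (?c \<mu>_opt l_opt t))"
    using online_stage_cost_bound[OF inst opt \<mu>_le l_le range_opt range_hat] by (intro sum_mono)
  thus ?thesis unfolding eq_hat eq_opt sum_subtractf by simp
qed

end
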